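(* On the three-dimensional cubic lattice $\mathbb{Z}^3$ place two qubits, of types $A$ and $B$, on every face ($2$-cell), with Pauli operators $X^\alpha_f,Z^\alpha_f$, $\alpha\in\{A,B\}$. For $\alpha\in\{A,B\}$ and each edge $e$ set $$G^\alpha_e=X^\alpha_{\delta \boldsymbol e}\prod_{f'}(Z^\alpha_{f'})^{\int \delta\boldsymbol e\cup_1\boldsymbol f'},$$ and for each face $f$ set $$\overline Z^A_f=Z^A_f\prod_{e}(G^B_e)^{\int \boldsymbol f\cup\boldsymbol e},\qquad \overline Z^B_f=Z^B_f\prod_{e}(G^A_e)^{\int \boldsymbol e\cup\boldsymbol f},$$ $$U^\alpha_f=X^\alpha_f\prod_{f'}(Z^\alpha_{f'})^{\int\boldsymbol f'\cup_1\boldsymbol f},\qquad \overline X^\alpha_f=U^\alpha_f\prod_{f'}(\overline Z^\alpha_{f'})^{\int\boldsymbol f'\cup_1\boldsymbol f},$$ equivalently $$\overline X^A_f=X^A_f\prod_{f'}\Big(\prod_e (G^B_e)^{\int\boldsymbol f'\cup\boldsymbol e}\Big)^{\int\boldsymbol f'\cup_1\boldsymbol f},\qquad \overline X^B_f=X^B_f\prod_{f'}\Big(\prod_e (G^A_e)^{\int\boldsymbol e\cup\boldsymbol f'}\Big)^{\int\boldsymbol f'\cup_1\boldsymbol f},$$ where $e$ runs over edges and $f'$ over faces. The assignment $$X^A_f\mapsto\overline X^A_f,\quad Z^A_f\mapsto\overline Z^A_f,\quad X^B_f\mapsto\overline X^B_f,\quad Z^B_f\mapsto\overline Z^B_f\qquad(\text{all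 faces } f)$$ defines a Clifford quantum cellular automaton, the 3-fermion QCA, and this QCA squares exactly to the identity (as an automorphism of the group of Pauli operators modulo phases).
   Context: All operators are Pauli operators, considered modulo phases (so the ordering in products is irrelevant). A Clifford quantum cellular automaton (QCA) is here an automorphism of the group of Pauli operators modulo phases that preserves commutation relations and is locality-preserving: there is a finite radius such that each operator is mapped to an operator supported within that radius of its support. Cells: within each unit cube $v+[0,1]^3$, $v\in\mathbb{Z}^3$, a cell is denoted by a triple $(z_1,z_2,z_3)$ with $z_i\in\{0,1,\bullet\}$; $\bullet$ means that the $i$-th coordinate (relative to $v$) ranges over $[0,1]$, and otherwise that coordinate is fixed to $z_i$. Edges have one $\bullet$, faces two, and the cube itself is $(\bullet,\bullet,\bullet)$. Cochains take values in $\mathbb{Z}_2$; $\boldsymbol e$, $\boldsymbol f$ denote the indicator cochains of an edge $e$ and a face $f$; $(\delta a)(c)=a(\partial c)$, where $\partial c$ is the mod-2 sum of the codimension-one cells in the boundary of $c$; $X_{\delta\boldsymbol e}=\prod_f X_f^{(\delta\boldsymbol e)(f)}$. The symbol $\int$ denotes the sum over all unit cubes of the value on the cube, mod 2. For cochains $A_p,B_q$ of the indicated degrees $p,q$, the products evaluated on each cube are (mod 2) $$(A_2\cup B_1)(\bullet,\bullet,\bullet)=A_2(0,\bullet,\bullet)B_1(\bullet,1,1)+A_2(\bullet,0,\bullet)B_1(1,\bullet,1)+A_2(\bullet,\bullet,0)B_1(1,1,\bullet),$$ $$(A_1\cup B_2)(\bullet,\bullet,\bullet)=A_1(0,0,\bullet)B_2(\bullet,\bullet,1)+A_1(0,\bullet,0)B_2(\bullet,1,\bullet)+A_1(\bullet,0,0)B_2(1,\bullet,\bullet),$$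 $$(A_2\cup_1B_2)(\bullet,\bullet,\bullet)=A_2(\bullet,1,\bullet)B_2(\bullet,\bullet,0)+A_2(\bullet,\bullet,1)B_2(\bullet,0,\bullet)+A_2(0,\bullet,\bullet)B_2(\bullet,\bullet,0)+A_2(0,\bullet,\bullet)B_2(\bullet,1,\bullet)+A_2(\bullet,\bullet,1)B_2(1,\bullet,\bullet)+A_2(\bullet,0,\bullet)B_2(1,\bullet,\bullet).$$ This QCA is constructed from the topological action $\frac12\int A_2\cup A_2+B_2\cup B_2+A_2\cup B_2$ of the 3-fermion Walker–Wang model in three spatial dimensions. *)

theory Defs
  imports
    "HOL-Analysis.Product_Vector"
    "HOL-Library.Poly_Mapping"
    "HOL-Library.Z2"
begin

section \<open>Cells of the cubic lattice\<close>

text \<open>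
  A cell is a product of three factors, each a lattice point \<open>Pt n\<close> = \<open>{n}\<close> or a unit
  interval \<open>Iv n\<close> = \<open>[n, n + 1]\<close>. Each geometric cell thus has exactly one
  representation, whereas it is a cell of several unit cubes.
\<close>

datatype coord = Pt int | Iv int

type_synonym cell = "coord \<times> coord \<times> coord"

fun coord_dim :: "coord \<Rightarrow> nat" where
  "coord_dim (Pt n) = 0"
| "coord_dim (Iv n) = 1"

fun cell_dim :: "cell \<Rightarrow> nat" where
  "cell_dim (a, b, c) = coord_dim a + coord_dim b + coord_dim c"

typedef edge = "{c :: cell. cell_dim c = 1}" morphisms edge_cell Edge
  by (rule exI[of _ "(Iv 0, Pt 0, Pt 0)"]) simp

typedef face = "{c :: cell. cell_dim c = 2}" morphisms face_cell Face
  by (rule exI[of _ "(Iv 0, Iv 0, Pt 0)"]) simp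

fun coord_mid :: "coord \<Rightarrow> real" where
  "coord_mid (Pt n) = of_int n"
| "coord_mid (Iv n) = of_int n + 1 / 2"

fun cell_center :: "cell \<Rightarrow> real \<times> real \<times> real" where
  "cell_center (a, b, c) = (coord_mid a, coord_mid b, coord_mid c)"

text \<open>
  The unit cube \<open>v + [0,1]\<^sup>3\<close> is given by its corner \<open>v\<close>. The cells of this cube are
  denoted by triples of symbols, where \<open>Lo\<close>, \<open>Hi\<close>, \<open>Full\<close> stand for the symbols 0, 1 and
  the bullet.
\<close>

type_synonym cube = "int \<times> int \<times> int"

datatype cell_sym = Lo | Hi | Full

fun coord_at :: "int \<Rightarrow> cell_sym \<Rightarrow> coord" where
  "coord_at n Lo = Pt n"
| "coord_at n Hi = Pt (n + 1)"
| "coord_at n Full = Iv n"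

fun cell_at :: "cube \<Rightarrow> cell_sym \<times> cell_sym \<times> cell_sym \<Rightarrow> cell" where
  "cell_at (i, j, k) (x, y, z) = (coord_at i x, coord_at j y, coord_at k z)"

fun coord_ends :: "coord \<Rightarrow> coord set" where
  "coord_ends (Pt n) = {}"
| "coord_ends (Iv n) = {Pt n, Pt (n + 1)}"

fun cell_boundary :: "cell \<Rightarrow> cell set" where
  "cell_boundary (a, b, c) =
     {(a', b, c) | a'. a' \<in> coord_ends a} \<union>
     {(a, b', c) | b'. b' \<in> coord_ends b} \<union>
     {(a, b, c') | c'. c' \<in> coord_ends c}"


section \<open>Cochains with values in the field of two elements\<close>

text \<open>
  Cochains of all degrees are functions on the set of all cells; a cochain of degree \<open>p\<close> is
  one that is used on \<open>p\<close>-cells only.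
\<close>

type_synonym cochain = "cell \<Rightarrow> bit"

definition indicator_cochain :: "cell \<Rightarrow> cochain" where
  "indicator_cochain c = (\<lambda>c'. of_bool (c' = c))"

abbreviation edge_cochain :: "edge \<Rightarrow> cochain" where
  "edge_cochain e \<equiv> indicator_cochain (edge_cell e)"

abbreviation face_cochain :: "face \<Rightarrow> cochain" where
  "face_cochain f \<equiv> indicator_cochain (face_cell f)"

definition coboundary :: "cochain \<Rightarrow> cochain" where
  "coboundary a c = (\<Sum>c'\<in>cell_boundary c. a c')"

definition cup21 :: "cochain \<Rightarrow> cochain \<Rightarrow> cube \<Rightarrow> bit" where
  "cup21 A B v =
     A (cell_at v (Lo, Full, Full)) * B (cell_at v (Full, Hi, Hi)) +
     A (cell_at v (Full, Lo, Full)) * B (cell_at v (Hi, Full, Hi)) +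
     A (cell_at v (Full, Full, Lo)) * B (cell_at v (Hi, Hi, Full))"

definition cup12 :: "cochain \<Rightarrow> cochain \<Rightarrow> cube \<Rightarrow> bit" where
  "cup12 A B v =
     A (cell_at v (Lo, Lo, Full)) * B (cell_at v (Full, Full, Hi)) +
     A (cell_at v (Lo, Full, Lo)) * B (cell_at v (Full, Hi, Full)) +
     A (cell_at v (Full, Lo, Lo)) * B (cell_at v (Hi, Full, Full))"

text \<open>The cup-1 product of two cochains of degree 2.\<close>

definition cup1 :: "cochain \<Rightarrow> cochain \<Rightarrow> cube \<Rightarrow> bit" where
  "cup1 A B v =
     A (cell_at v (Full, Hi, Full)) * B (cell_at v (Full, Full, Lo)) +
     A (cell_at v (Full, Full, Hi)) * B (cell_at v (Full, Lo, Full)) +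
     A (cell_at v (Lo, Full, Full)) * B (cell_at v (Full, Full, Lo)) +
     A (cell_at v (Lo, Full, Full)) * B (cell_at v (Full, Hi, Full)) +
     A (cell_at v (Full, Full, Hi)) * B (cell_at v (Hi, Full, Full)) +
     A (cell_at v (Full, Lo, Full)) * B (cell_at v (Hi, Full, Full))"

text \<open>
  \<open>Sum_any\<close> is the sum over a whole type of a function with finite support (and 0 if the
  support is infinite). It is only applied below to functions of finite support: an indicator
  cochain or its coboundary is nonzero on finitely many cells, and a product of cochains on
  a cube only involves cells of that cube.
\<close>

definition cube_integral :: "(cube \<Rightarrow> bit) \<Rightarrow> bit" where
  "cube_integral F = Sum_any F"


section \<open>Pauli operators modulo phases\<close>

datatype species = SpA | SpB

type_synonym qubit = "species \<times> face"

text \<open>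
  A Pauli operator modulo phase is a finite product of single-qubit operators
  \<open>X\<^sup>a Z\<^sup>b\<close>, recorded as the finitely supported function mapping a qubit to \<open>(a, b)\<close>.
  The group law (product of operators modulo phases) is written additively, with unit 0.
  The support of an operator is \<open>Poly_Mapping.keys\<close>.
\<close>

type_synonym pauli = "qubit \<Rightarrow>\<^sub>0 bit \<times> bit"

definition pauliX :: "species \<Rightarrow> face \<Rightarrow> pauli" where
  "pauliX s f = Poly_Mapping.single (s, f) (1, 0)"

definition pauliZ :: "species \<Rightarrow> face \<Rightarrow> pauli" where
  "pauliZ s f = Poly_Mapping.single (s, f) (0, 1)"

definition pauli_pow :: "pauli \<Rightarrow> bit \<Rightarrow> pauli" where
  "pauli_pow P b = (if b = 1 then P else 0)"

text \<open>
  Since \<open>X Z = - Z X\<close>, the operators \<open>X\<^sup>a Z\<^sup>b\<close> and \<open>X\<^sup>c Z\<^sup>d\<close> on one qubit commute up to the sign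
  \<open>(-1)\<^bsup>ad + bc\<^esup>\<close>; Pauli operators commute if the product of these signs over all qubits is 1.
\<close>

definition commutator_exponent :: "pauli \<Rightarrow> pauli \<Rightarrow> bit" where
  "commutator_exponent P Q =
     Sum_any (\<lambda>q. fst (Poly_Mapping.lookup P q) * snd (Poly_Mapping.lookup Q q) +
                  snd (Poly_Mapping.lookup P q) * fst (Poly_Mapping.lookup Q q))"

definition pauli_commute :: "pauli \<Rightarrow> pauli \<Rightarrow> bool" where
  "pauli_commute P Q \<longleftrightarrow> commutator_exponent P Q = 0"

definition qubit_position :: "qubit \<Rightarrow> real \<times> real \<times> real" where
  "qubit_position q = cell_center (face_cell (snd q))"

definition locality_preserving :: "(pauli \<Rightarrow> pauli) \<Rightarrow> bool" where
  "locality_preserving \<alpha> \<longleftrightarrow>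
     (\<exists>r. \<forall>P. \<forall>q \<in> Poly_Mapping.keys (\<alpha> P). \<exists>q' \<in> Poly_Mapping.keys P.
        dist (qubit_position q) (qubit_position q') \<le> r)"

definition clifford_QCA :: "(pauli \<Rightarrow> pauli) \<Rightarrow> bool" where
  "clifford_QCA \<alpha> \<longleftrightarrow>
     bij \<alpha> \<and> additive \<alpha> \<and>
     (\<forall>P Q. pauli_commute (\<alpha> P) (\<alpha> Q) \<longleftrightarrow> pauli_commute P Q) \<and>
     locality_preserving \<alpha>"


section \<open>The operators defining the 3-fermion QCA\<close>

definition opG :: "species \<Rightarrow> edge \<Rightarrow> pauli" where
  "opG s e =
     Sum_any (\<lambda>f. pauli_pow (pauliX s f) (coboundary (edge_cochain e) (face_cell f))) +
     Sum_any (\<lambda>f'. pauli_pow (pauliZ s f')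
       (cube_integral (cup1 (coboundary (edge_cochain e)) (face_cochain f'))))"

text \<open>The factor multiplying \<open>Z\<close> in the image of \<open>Z\<close>.\<close>

fun dressing :: "species \<Rightarrow> face \<Rightarrow> pauli" where
  "dressing SpA f =
     Sum_any (\<lambda>e. pauli_pow (opG SpB e)
       (cube_integral (cup21 (face_cochain f) (edge_cochain e))))"
| "dressing SpB f =
     Sum_any (\<lambda>e. pauli_pow (opG SpA e)
       (cube_integral (cup12 (edge_cochain e) (face_cochain f))))"

definition Zbar :: "species \<Rightarrow> face \<Rightarrow> pauli" where
  "Zbar s f = pauliZ s f + dressing s f"

definition opU :: "species \<Rightarrow> face \<Rightarrow> pauli" where
  "opU s f = pauliX s f +
     Sum_any (\<lambda>f'. pauli_pow (pauliZ s f')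
       (cube_integral (cup1 (face_cochain f') (face_cochain f))))"

definition Xbar :: "species \<Rightarrow> face \<Rightarrow> pauli" where
  "Xbar s f = opU s f +
     Sum_any (\<lambda>f'. pauli_pow (Zbar s f')
       (cube_integral (cup1 (face_cochain f') (face_cochain f))))"

definition three_fermion_assignment :: "(pauli \<Rightarrow> pauli) \<Rightarrow> bool" where
  "three_fermion_assignment \<alpha> \<longleftrightarrow>
     (\<forall>s f. \<alpha> (pauliX s f) = Xbar s f \<and> \<alpha> (pauliZ s f) = Zbar s f)"

end

theory Submission
  imports Defs
begin

text \<open>
  Let \<open>V\<^sub>f\<close> (\<open>opV\<close>) be the product of \<open>X\<^sub>f\<close> and all \<open>Z\<^sub>g\<close> with \<open>\<integral> f \<union>\<^sub>1 g = 1\<close>, for each species.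
  Everything is expressed by the symplectic form \<open>\<omega>\<close> (\<open>commutator_exponent\<close>) and these operators.

  The value \<open>\<omega>(P, V\<^sub>f)\<close> is the exponent with which the dressing of \<open>f\<close> enters the prescribed image of
  a generator \<open>P\<close> of type \<open>X\<close> or \<open>Z\<close>. Hence the assignment extends to \<open>\<alpha> = 1 + N\<close>, where \<open>N P\<close> (\<open>twist\<close>) is the
  product of the dressings of the qubits \<open>q\<close> with \<open>\<omega>(P, V\<^sub>q) = 1\<close>. Three facts about \<open>N\<close> suffice.

  Self-adjointness. Pairing faces with edges by the cup product is a bijection that shifts every
  coordinate by half a unit: \<open>f \<union> e\<close> integrates to 1 iff \<open>e = D f\<close>, and \<open>e \<union> f\<close> iff \<open>e = D\<^sup>-\<^sup>1 f\<close>.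
  So the dressings are \<open>G\<^sub>e\<close> with \<open>e = D f\<close> or \<open>e = D\<^sup>-\<^sup>1 f\<close>, and \<open>G\<^sub>e\<close> is the product of \<open>V\<^sub>g\<close> over the
  faces \<open>g\<close> that contain \<open>e\<close> (\<open>opG_eq\<close>). Since \<open>D\<close> exchanges boundaries and coboundaries, the
  relation that \<open>V\<^sub>r\<close> is a factor of the dressing of \<open>q\<close> is symmetric (\<open>linked_commute\<close>), whence
  \<open>\<omega>(N P, Q) = \<omega>(P, N Q)\<close>.

  Isotropy. All \<open>G\<^sub>e\<close> commute (\<open>opG_commute\<close>). Indeed the symmetrization of the cup-1 product is the sum
  over all cubes of \<open>T \<otimes> T + T' \<otimes> T'\<close>, where \<open>T\<close> and \<open>T'\<close> add up the values on two complementary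
  triples of faces of the cube (\<open>cup1_pairing_symmetrized\<close>); on a coboundary \<open>T + T'\<close> vanishes, so
  that the two terms cancel. Hence \<open>\<omega>(N P, N Q) = 0\<close>.

  Nilpotency. By the two facts above \<open>\<omega>(N (N P), Q) = 0\<close> for all \<open>Q\<close>, and \<open>\<omega>\<close> is
  nondegenerate, so \<open>N\<^sup>2 = 0\<close>.

  In characteristic 2 this gives \<open>\<alpha>\<^sup>2 = 1 + 2 N + N\<^sup>2 = 1\<close> and
  \<open>\<omega>(\<alpha> P, \<alpha> Q) = \<omega>(P, Q) + 2 \<omega>(N P, Q) + \<omega>(N P, N Q) = \<omega>(P, Q)\<close>.
\<close>

section \<open>Sums of finite support\<close>

lemma Sum_any_eq_sum:
  assumes "finite A" "\<And>i. i \<notin> A \<Longrightarrow> g i = 0"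
  shows "Sum_any g = sum g A"
  using assms by (intro Sum_any.expand_superset) auto

lemma additive_Sum_any:
  fixes h :: "'b::ab_group_add \<Rightarrow> 'c::ab_group_add"
  assumes "additive h" "finite {i. g i \<noteq> 0}"
  shows "h (Sum_any g) = Sum_any (\<lambda>i. h (g i))"
proof -
  have "Sum_any (\<lambda>i. h (g i)) = (\<Sum>i\<in>{i. g i \<noteq> 0}. h (g i))"
    using assms by (intro Sum_any_eq_sum) (auto simp: additive.zero)
  then show ?thesis
    using assms by (simp add: Sum_any.expand_set additive.sum)
qed

lemma Sum_any_sum:
  assumes "finite J" "\<And>j. j \<in> J \<Longrightarrow> finite {i. g j i \<noteq> 0}"
  shows "Sum_any (\<lambda>i. \<Sum>j\<in>J. g j i) = (\<Sum>j\<in>J. Sum_any (g j))"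
proof -
  define A where "A = (\<Union>j\<in>J. {i. g j i \<noteq> 0})"
  have "finite A" using assms by (auto simp: A_def)
  then have "Sum_any (\<lambda>i. \<Sum>j\<in>J. g j i) = (\<Sum>i\<in>A. \<Sum>j\<in>J. g j i)"
    by (intro Sum_any_eq_sum) (auto simp: A_def intro!: sum.neutral)
  also have "\<dots> = (\<Sum>j\<in>J. \<Sum>i\<in>A. g j i)" by (rule sum.swap)
  also have "\<dots> = (\<Sum>j\<in>J. Sum_any (g j))"
    using \<open>finite A\<close> by (intro sum.cong refl Sum_any_eq_sum[symmetric]) (auto simp: A_def)
  finally show ?thesis .
qed

lemma Sum_any_reindex:
  assumes "inj h" "\<And>i. i \<notin> range h \<Longrightarrow> g i = 0"
  shows "Sum_any g = Sum_any (\<lambda>i. g (h i))"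
proof -
  have "{i. g i \<noteq> 0} = h ` {i. g (h i) \<noteq> 0}"
    using assms(2) by (auto simp: image_iff) (metis rangeE)
  then show ?thesis
    using assms(1) by (simp add: Sum_any.expand_set sum.reindex inj_on_subset comp_def)
qed

lemma Sum_any_of_bool_eq:
  "Sum_any (\<lambda>i. of_bool (i = a \<and> p) :: bit) = of_bool p"
  by (subst Sum_any_eq_sum[of "{a}"]) auto

lemma bit_add_self: "(b::bit) + b = 0"
  by simp

section \<open>Proximity of cells\<close>

text \<open>
  Finiteness of supports and locality both come from bounds in the maximum metric on cell
  centres; an integer radius suffices and makes such bounds add up without side conditions.
\<close>

fun coord_near :: "nat \<Rightarrow> coord \<Rightarrow> coord \<Rightarrow> bool" where
  "coord_near r a b \<longleftrightarrow> \<bar>coord_mid a - coord_mid b\<bar> \<le> real r"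

fun cell_near :: "nat \<Rightarrow> cell \<Rightarrow> cell \<Rightarrow> bool" where
  "cell_near r (a, b, c) (a', b', c') \<longleftrightarrow> coord_near r a a' \<and> coord_near r b b' \<and> coord_near r c c'"

lemma cell_near_refl: "cell_near r c c"
  by (cases c) auto

lemma cell_near_sym: "cell_near r c c' \<Longrightarrow> cell_near r c' c"
  by (cases c; cases c') auto

lemma cell_near_trans: "cell_near r c c' \<Longrightarrow> cell_near s c' c'' \<Longrightarrow> cell_near (r + s) c c''"
  by (cases c; cases c'; cases c'') auto

lemma dist_cell_near:
  assumes "cell_near r c c'"
  shows "dist (cell_center c) (cell_center c') \<le> 3 * real r"
proof -
  obtain x y z where c: "c = (x, y, z)" by (cases c)
  obtain x' y' z' where c': "c' = (x', y', z')" by (cases c')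
  have "dist (cell_center c) (cell_center c') \<le>
    dist (coord_mid x) (coord_mid x') + (dist (coord_mid y) (coord_mid y') + dist (coord_mid z) (coord_mid z'))"
    unfolding c c' cell_center.simps dist_Pair_Pair
    by (intro order.trans[OF sqrt_sum_squares_le_sum] add_left_mono) auto
  with assms show ?thesis by (simp add: c c' dist_real_def)
qed

lemma finite_coord_near: "finite {b. coord_near r a b}"
proof -
  define n where "n = \<lfloor>coord_mid a\<rfloor>"
  have "{b. coord_near r a b} \<subseteq> Pt ` {n - int r - 2 .. n + int r + 2} \<union> Iv ` {n - int r - 2 .. n + int r + 2}"
  proof
    fix b assume "b \<in> {b. coord_near r a b}"
    then show "b \<in> Pt ` {n - int r - 2 .. n + int r + 2} \<union> Iv ` {n - int r - 2 .. n + int r + 2}"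
      unfolding n_def by (cases b) (auto intro!: imageI; linarith)+
  qed
  then show ?thesis by (rule finite_subset) auto
qed

lemma finite_cell_near: "finite {c'. cell_near r c c'}"
proof -
  obtain x y z where c: "c = (x, y, z)" by (cases c)
  have "{c'. cell_near r c c'} = {b. coord_near r x b} \<times> {b. coord_near r y b} \<times> {b. coord_near r z b}"
    by (auto simp: c)
  then show ?thesis by (simp only: finite_coord_near finite_cartesian_product)
qed

lemma finite_face_near: "finite {f. cell_near r c (face_cell f)}"
proof (rule finite_imageD)
  show "finite (face_cell ` {f. cell_near r c (face_cell f)})"
    by (rule finite_subset[OF _ finite_cell_near[of r c]]) auto
qed (auto simp: inj_on_def face_cell_inject)

lemma coord_near_at: "coord_near 1 (coord_at n x) (coord_at n y)"
  by (cases x; cases y) auto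

lemma cell_near_at: "cell_near 1 (cell_at v x) (cell_at v y)"
  by (cases v; cases x; cases y) (simp only: cell_at.simps cell_near.simps coord_near_at simp_thms)

lemma coord_near_ends: "a' \<in> coord_ends a \<Longrightarrow> coord_near 1 a a'"
  by (cases a) auto

lemma cell_near_boundary: "c' \<in> cell_boundary c \<Longrightarrow> cell_near 1 c c'"
  by (cases c) (auto simp del: coord_near.simps One_nat_def simp: coord_near_ends, auto)

lemma finite_coord_at: "finite {n. coord_at n x = a}"
proof (rule finite_subset)
  show "{n. coord_at n x = a} \<subseteq> (case a of Pt m \<Rightarrow> {m - 1, m} | Iv m \<Rightarrow> {m})"
    by (cases x; cases a) auto
qed (auto split: coord.splits)

lemma finite_cell_at: "finite {v. cell_at v x = c}"
proof -
  obtain x1 x2 x3 where x: "x = (x1, x2, x3)" by (cases x)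
  obtain a1 a2 a3 where c: "c = (a1, a2, a3)" by (cases c)
  have "{v. cell_at v x = c} = {n. coord_at n x1 = a1} \<times> {n. coord_at n x2 = a2} \<times> {n. coord_at n x3 = a3}"
    by (auto simp: x c)
  then show ?thesis by (simp only: finite_coord_at finite_cartesian_product)
qed

section \<open>The symmetrized cup-1 product\<close>

definition cup1_pairing :: "face \<Rightarrow> face \<Rightarrow> bit" where
  "cup1_pairing f f' = cube_integral (cup1 (face_cochain f) (face_cochain f'))"

lemma finite_support_at:
  "finite {v. indicator_cochain c (cell_at v x) * B v \<noteq> (0::bit)}"
  by (rule finite_subset[OF _ finite_cell_at[of x c]]) (auto simp: indicator_cochain_def)

lemma finite_nonzero_add:
  assumes "finite {v. g v \<noteq> (0::'a::comm_monoid_add)}" "finite {v. h v \<noteq> 0}"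
  shows "finite {v. g v + h v \<noteq> 0}"
  by (rule finite_subset[OF _ finite_UnI[OF assms]]) auto

lemma finite_support_cup1: "finite {v. cup1 (indicator_cochain c) B v \<noteq> 0}"
  unfolding cup1_def by (intro finite_nonzero_add finite_support_at)

lemma cup1_pairing_near:
  assumes "cup1_pairing f f' \<noteq> 0"
  shows "cell_near 1 (face_cell f) (face_cell f')"
proof (rule ccontr)
  assume far: "\<not> cell_near 1 (face_cell f) (face_cell f')"
  have "face_cochain f (cell_at v x) * face_cochain f' (cell_at v y) = 0" for v x y
    using far cell_near_at[of v x y] unfolding indicator_cochain_def by auto
  then have "cup1 (face_cochain f) (face_cochain f') v = 0" for v
    by (simp only: cup1_def add_0_right)
  with assms show False by (simp add: cup1_pairing_def cube_integral_def)
qed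

lemma finite_cup1_pairing: "finite {f'. cup1_pairing f f' \<noteq> 0}"
  by (rule finite_subset[OF _ finite_face_near]) (intro subsetI CollectI, rule cup1_pairing_near, simp)

lemma finite_cup1_pairing': "finite {f'. cup1_pairing f' f \<noteq> 0}"
  by (rule finite_subset[OF _ finite_face_near])
    (intro subsetI CollectI, rule cell_near_sym, rule cup1_pairing_near, simp)

text \<open>
  Two faces of a cube that occur together in a term of the cup-1 product lie in the same one of two
  triples, each of which meets every pair of opposite faces once; all six pairs within the
  triples occur.
\<close>

fun triangle_lo :: "cube \<Rightarrow> cochain \<Rightarrow> bit" where
  "triangle_lo v A =
     A (cell_at v (Lo, Full, Full)) + A (cell_at v (Full, Hi, Full)) + A (cell_at v (Full, Full, Lo))"

fun triangle_hi :: "cube \<Rightarrow> cochain \<Rightarrow> bit" where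
  "triangle_hi v A =
     A (cell_at v (Hi, Full, Full)) + A (cell_at v (Full, Lo, Full)) + A (cell_at v (Full, Full, Hi))"

lemma cube_integral_add:
  assumes "finite {v. g v \<noteq> 0}" "finite {v. h v \<noteq> 0}"
  shows "cube_integral (\<lambda>v. g v + h v) = cube_integral g + cube_integral h"
  unfolding cube_integral_def using assms by (rule Sum_any.distrib)

lemma cube_integral_shift:
  "cube_integral (\<lambda>v. g (v + w)) = cube_integral g"
  unfolding cube_integral_def
proof (rule Sum_any_reindex[symmetric])
  show "inj (\<lambda>v. v + w)" by (rule injI) simp
  show "g v = 0" if "v \<notin> range (\<lambda>v. v + w)" for v
    using that rangeI[of "\<lambda>v. v + w" "v - w"] by simp
qed

text \<open>
  A face is a lower face of one cube and an upper face of a neighbouring one, so its contributions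
  to an integral over opposite faces cancel mod 2.
\<close>

lemma cube_integral_opposite:
  fixes A B :: cochain
  assumes "A = indicator_cochain c"
  shows "cube_integral (\<lambda>v. A (cell_at v (Lo, Full, Full)) * B (cell_at v (Lo, Full, Full))
           + A (cell_at v (Hi, Full, Full)) * B (cell_at v (Hi, Full, Full))) = 0"
    and "cube_integral (\<lambda>v. A (cell_at v (Full, Lo, Full)) * B (cell_at v (Full, Lo, Full))
           + A (cell_at v (Full, Hi, Full)) * B (cell_at v (Full, Hi, Full))) = 0"
    and "cube_integral (\<lambda>v. A (cell_at v (Full, Full, Lo)) * B (cell_at v (Full, Full, Lo))
           + A (cell_at v (Full, Full, Hi)) * B (cell_at v (Full, Full, Hi))) = 0"
proof -
  have shift: "cell_at v (Hi, Full, Full) = cell_at (v + (1, 0, 0)) (Lo, Full, Full)"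
    "cell_at v (Full, Hi, Full) = cell_at (v + (0, 1, 0)) (Full, Lo, Full)"
    "cell_at v (Full, Full, Hi) = cell_at (v + (0, 0, 1)) (Full, Full, Lo)" for v
    by (cases v; simp)+
  have *: "cube_integral (\<lambda>v. A (cell_at v x) * B (cell_at v x)
      + A (cell_at (v + w) x) * B (cell_at (v + w) x)) = 0" for w x
  proof -
    let ?g = "\<lambda>v. A (cell_at v x) * B (cell_at v x)"
    have fin: "finite {v. ?g v \<noteq> 0}" unfolding assms by (rule finite_support_at)
    have "finite {v. ?g (v + w) \<noteq> 0}"
      using finite_vimageI[OF fin, of "\<lambda>v. v + w"] by (simp add: vimage_def inj_def)
    then show ?thesis
      using fin by (simp only: cube_integral_add cube_integral_shift[of ?g] bit_add_self)
  qed
  show "cube_integral (\<lambda>v. A (cell_at v (Lo, Full, Full)) * B (cell_at v (Lo, Full, Full))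
           + A (cell_at v (Hi, Full, Full)) * B (cell_at v (Hi, Full, Full))) = 0"
    and "cube_integral (\<lambda>v. A (cell_at v (Full, Lo, Full)) * B (cell_at v (Full, Lo, Full))
           + A (cell_at v (Full, Hi, Full)) * B (cell_at v (Full, Hi, Full))) = 0"
    and "cube_integral (\<lambda>v. A (cell_at v (Full, Full, Lo)) * B (cell_at v (Full, Full, Lo))
           + A (cell_at v (Full, Full, Hi)) * B (cell_at v (Full, Full, Hi))) = 0"
    unfolding shift by (rule *)+
qed

lemma finite_support_triangles:
  "finite {v. triangle_lo v (indicator_cochain c) * B v \<noteq> 0}"
  "finite {v. triangle_hi v (indicator_cochain c) * B v \<noteq> 0}"
  unfolding triangle_lo.simps triangle_hi.simps distrib_right
  by (intro finite_nonzero_add finite_support_at)+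

text \<open>
  The names \<open>x0, x1, \<dots>\<close> and \<open>u0, u1, \<dots>\<close> are the values of two cochains on the
  six faces of a cube. The products of the triangle sums contain the off-diagonal terms on the left
  and the diagonal ones; the latter occur twice on the right.
\<close>

lemma triangle_identity:
  fixes x0 :: bit
  shows "(y1*w0 + z1*v0 + x0*w0 + x0*v1 + z1*u1 + y0*u1)
      + (v1*z0 + w1*y0 + u0*z0 + u0*y1 + w1*x1 + v0*x1) =
      (x0 + y1 + z0) * (u0 + v1 + w0) + (x1 + y0 + z1) * (u1 + v0 + w1)
      + ((x0*u0 + x1*u1) + ((y0*v0 + y1*v1) + (z0*w0 + z1*w1)))"
proof -
  have "(x0 + y1 + z0) * (u0 + v1 + w0) + (x1 + y0 + z1) * (u1 + v0 + w1)
      + ((x0*u0 + x1*u1) + ((y0*v0 + y1*v1) + (z0*w0 + z1*w1))) =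
      ((y1*w0 + z1*v0 + x0*w0 + x0*v1 + z1*u1 + y0*u1)
      + (v1*z0 + w1*y0 + u0*z0 + u0*y1 + w1*x1 + v0*x1))
      + (((x0*u0 + x1*u1) + ((y0*v0 + y1*v1) + (z0*w0 + z1*w1)))
       + ((x0*u0 + x1*u1) + ((y0*v0 + y1*v1) + (z0*w0 + z1*w1))))" for x0 :: "'a::comm_ring" and x1 y0 y1 z0 z1 u0 u1 v0 v1 w0 w1
    by (simp only: distrib_left distrib_right ac_simps)
  from this[of x0 y1 z0 u0 v1 w0 x1 y0 z1 u1 v0 w1] show ?thesis
    by (simp only: bit_add_self add_0_right)
qed

text \<open>
  The symmetrized cup-1 product takes a diagonal form: besides the squares of the
  triangle sums, only terms on single faces remain, and these cancel between neighbouring cubes.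
\<close>

lemma cup1_pairing_symmetrized:
  "cup1_pairing f f' + cup1_pairing f' f =
     cube_integral (\<lambda>v. triangle_lo v (face_cochain f) * triangle_lo v (face_cochain f')
       + triangle_hi v (face_cochain f) * triangle_hi v (face_cochain f'))"
proof -
  define A B where "A = face_cochain f" and "B = face_cochain f'"
  define t where "t v = triangle_lo v A * triangle_lo v B + triangle_hi v A * triangle_hi v B" for v
  define gx where "gx v = A (cell_at v (Lo, Full, Full)) * B (cell_at v (Lo, Full, Full))
           + A (cell_at v (Hi, Full, Full)) * B (cell_at v (Hi, Full, Full))" for v
  define gy where "gy v = A (cell_at v (Full, Lo, Full)) * B (cell_at v (Full, Lo, Full))
           + A (cell_at v (Full, Hi, Full)) * B (cell_at v (Full, Hi, Full))" for v
  define gz where "gz v = A (cell_at v (Full, Full, Lo)) * B (cell_at v (Full, Full, Lo))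
           + A (cell_at v (Full, Full, Hi)) * B (cell_at v (Full, Full, Hi))" for v
  have fin: "finite {v. t v \<noteq> 0}" "finite {v. gx v \<noteq> 0}" "finite {v. gy v \<noteq> 0}" "finite {v. gz v \<noteq> 0}"
    unfolding t_def gx_def gy_def gz_def A_def
    by (intro finite_nonzero_add finite_support_at finite_support_triangles)+
  have local: "cup1 A B v + cup1 B A v = t v + (gx v + (gy v + gz v))" for v
    unfolding cup1_def t_def gx_def gy_def gz_def triangle_lo.simps triangle_hi.simps
    by (rule triangle_identity)
  have "cup1_pairing f f' + cup1_pairing f' f = cube_integral (\<lambda>v. cup1 A B v + cup1 B A v)"
    unfolding cup1_pairing_def A_def B_def
    by (intro cube_integral_add[symmetric] finite_support_cup1)
  also have "\<dots> = cube_integral t + (cube_integral gx + (cube_integral gy + cube_integral gz))"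
    unfolding local by (simp only: cube_integral_add finite_nonzero_add fin)
  also have "\<dots> = cube_integral t"
    using cube_integral_opposite[of A "face_cell f" B, OF A_def]
    by (simp only: gx_def[abs_def] gy_def[abs_def] gz_def[abs_def] add_0_right)
  finally show ?thesis by (simp only: t_def[abs_def] A_def B_def)
qed

section \<open>Coboundaries of edges\<close>

definition cofaces :: "edge \<Rightarrow> face set" where
  "cofaces e = {f. edge_cell e \<in> cell_boundary (face_cell f)}"

lemma cofaces_near: "f \<in> cofaces e \<Longrightarrow> cell_near 1 (edge_cell e) (face_cell f)"
  unfolding cofaces_def using cell_near_boundary cell_near_sym by blast

lemma finite_cofaces: "finite (cofaces e)"
  by (rule finite_subset[OF _ finite_face_near]) (intro subsetI CollectI, rule cofaces_near)

lemma finite_cell_boundary: "finite (cell_boundary c)"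
proof -
  have fin: "finite (coord_ends a)" for a by (cases a) auto
  obtain x y z where c: "c = (x, y, z)" by (cases c)
  have "cell_boundary c = (\<lambda>a. (a, y, z)) ` coord_ends x \<union> (\<lambda>a. (x, a, z)) ` coord_ends y
      \<union> (\<lambda>a. (x, y, a)) ` coord_ends z"
    by (auto simp: c)
  then show ?thesis by (simp add: fin)
qed

lemma coboundary_indicator:
  "coboundary (indicator_cochain c) c' = of_bool (c \<in> cell_boundary c')"
  unfolding coboundary_def indicator_cochain_def
  using finite_cell_boundary[of c'] by (simp add: sum.delta of_bool_def)

lemma cell_dim_boundary: "c \<in> cell_boundary c' \<Longrightarrow> cell_dim c' = Suc (cell_dim c)"
proof -
  have *: "a' \<in> coord_ends a \<Longrightarrow> coord_dim a = Suc (coord_dim a')" for a a' by (cases a) auto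
  show "c \<in> cell_boundary c' \<Longrightarrow> ?thesis"
    by (cases c'; cases c) (auto dest: *)
qed

lemma coboundary_edge:
  "coboundary (edge_cochain e) c = (\<Sum>f\<in>cofaces e. face_cochain f c)"
proof (cases "edge_cell e \<in> cell_boundary c")
  case True
  have "cell_dim (edge_cell e) = 1" using edge_cell[of e] by simp
  with True have "cell_dim c = 2" by (simp add: cell_dim_boundary)
  then obtain f where f: "c = face_cell f" by (metis Face_inverse mem_Collect_eq)
  with True have "f \<in> cofaces e" by (simp add: cofaces_def)
  have "(\<Sum>f\<in>cofaces e. face_cochain f c) = (\<Sum>f'\<in>cofaces e. if f = f' then 1 else 0)"
    by (intro sum.cong) (auto simp: f indicator_cochain_def face_cell_inject)
  with True \<open>f \<in> cofaces e\<close> show ?thesis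
    by (simp add: coboundary_indicator finite_cofaces)
next
  case False
  then show ?thesis
    unfolding coboundary_indicator
    by (subst sum.neutral) (auto simp: cofaces_def indicator_cochain_def)
qed

lemma cup1_sum_left: "cup1 (\<lambda>c. \<Sum>i\<in>I. A i c) B v = (\<Sum>i\<in>I. cup1 (A i) B v)"
  unfolding cup1_def by (simp only: sum_distrib_right sum.distrib)

lemma cup1_integral_coboundary:
  "cube_integral (cup1 (coboundary (edge_cochain e)) (face_cochain f')) =
     (\<Sum>f\<in>cofaces e. cup1_pairing f f')"
  unfolding coboundary_edge[abs_def] cup1_sum_left[abs_def] cup1_pairing_def cube_integral_def
  by (intro Sum_any_sum finite_cofaces finite_support_cup1)

lemma triangle_sum:
  "triangle_lo v (\<lambda>c. \<Sum>i\<in>I. A i c) = (\<Sum>i\<in>I. triangle_lo v (A i))"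
  "triangle_hi v (\<lambda>c. \<Sum>i\<in>I. A i c) = (\<Sum>i\<in>I. triangle_hi v (A i))"
  by (simp_all only: triangle_lo.simps triangle_hi.simps sum.distrib)

lemma boundary_bit:
  "(of_bool ((x, y, z) \<in> cell_boundary (a, b, c)) :: bit) =
     of_bool (x \<in> coord_ends a) * of_bool (y = b) * of_bool (z = c) +
     of_bool (x = a) * of_bool (y \<in> coord_ends b) * of_bool (z = c) +
     of_bool (x = a) * of_bool (y = b) * of_bool (z \<in> coord_ends c)"
proof -
  have "a \<notin> coord_ends a" for a by (cases a) auto
  then show ?thesis by auto
qed

lemma ends_bit:
  "(of_bool (x \<in> coord_ends (Iv n)) :: bit) = of_bool (x = Pt n) + of_bool (x = Pt (n + 1))"
  "(of_bool (x \<in> coord_ends (Pt n)) :: bit) = 0"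
  by auto

text \<open>
  The letters \<open>p0, p1, p\<close> are the indicators that the first coordinate of an edge is the lower end, the
  upper end or the full interval of that of a cube; \<open>q\<close> and \<open>r\<close> belong to the other two coordinates.
  The sum of both sides counts each edge of the cube twice, once for each of the two faces containing it.
\<close>

lemma boundary_of_boundary_identity:
  fixes p :: bit
  shows "p0 * (q0 + q1) * r + p0 * q * (r0 + r1)
      + ((p0 + p1) * q1 * r + p * q1 * (r0 + r1))
      + ((p0 + p1) * q * r0 + p * (q0 + q1) * r0)
    = p1 * (q0 + q1) * r + p1 * q * (r0 + r1)
      + ((p0 + p1) * q0 * r + p * q0 * (r0 + r1))
      + ((p0 + p1) * q * r1 + p * (q0 + q1) * r1)" (is "?lo = ?hi")
proof -
  define d where "d = (p0 + p1) * (q0 + q1) * r + (p0 + p1) * q * (r0 + r1) + p * (q0 + q1) * (r0 + r1)"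
  have "?lo + ?hi = d + d"
    unfolding d_def by (simp only: distrib_left distrib_right ac_simps)
  then show ?thesis by (metis add_right_cancel bit_add_self)
qed

text \<open>The two triangles together are the boundary of the cube, so this is \<open>\<delta>\<delta> = 0\<close>.\<close>

lemma triangles_coboundary:
  "triangle_lo v (coboundary (indicator_cochain c)) = triangle_hi v (coboundary (indicator_cochain c))"
proof -
  obtain i j k where v: "v = (i, j, k)" by (cases v)
  obtain x y z where c: "c = (x, y, z)" by (cases c)
  show ?thesis
    unfolding v c triangle_lo.simps triangle_hi.simps cell_at.simps coord_at.simps coboundary_indicator
      boundary_bit ends_bit mult_zero_left mult_zero_right add_0_left add_0_right
    by (rule boundary_of_boundary_identity)
qed

text \<open>
  By bilinearity each cube contributes \<open>T(\<delta>e) T(\<delta>e') + T'(\<delta>e) T'(\<delta>e')\<close>, and \<open>T = T'\<close> on coboundaries.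
\<close>

lemma cofaces_pairing_alternating:
  "(\<Sum>f\<in>cofaces e. \<Sum>f'\<in>cofaces e'. cup1_pairing f f' + cup1_pairing f' f) = 0"
proof -
  let ?lo = "\<lambda>v f. triangle_lo v (face_cochain f)" and ?hi = "\<lambda>v f. triangle_hi v (face_cochain f)"
  let ?F = "\<lambda>f f' v. ?lo v f * ?lo v f' + ?hi v f * ?hi v f'"
  have eq: "(\<Sum>f\<in>cofaces e. ?lo v f) = (\<Sum>f\<in>cofaces e. ?hi v f)" for v e
    using triangles_coboundary[of v "edge_cell e"]
    by (simp only: coboundary_edge[abs_def] triangle_sum)
  have fin: "finite {v. ?F f f' v \<noteq> 0}" for f f'
    by (intro finite_nonzero_add finite_support_triangles)
  have fin': "finite {v. (\<Sum>f'\<in>cofaces e'. ?F f f' v) \<noteq> 0}" for f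
    by (rule finite_subset[of _ "\<Union>f'\<in>cofaces e'. {v. ?F f f' v \<noteq> 0}"])
      (use finite_cofaces fin in \<open>blast elim: sum.not_neutral_contains_not_neutral\<close>)+
  have "(\<Sum>f\<in>cofaces e. \<Sum>f'\<in>cofaces e'. cup1_pairing f f' + cup1_pairing f' f) =
      (\<Sum>f\<in>cofaces e. \<Sum>f'\<in>cofaces e'. Sum_any (?F f f'))"
    by (simp only: cup1_pairing_symmetrized cube_integral_def)
  also have "\<dots> = Sum_any (\<lambda>v. \<Sum>f\<in>cofaces e. \<Sum>f'\<in>cofaces e'. ?F f f' v)"
    by (simp only: Sum_any_sum finite_cofaces fin fin')
  also have "(\<lambda>v. \<Sum>f\<in>cofaces e. \<Sum>f'\<in>cofaces e'. ?F f f' v) = (\<lambda>v. 0)"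
    by (simp only: sum.distrib flip: sum_product) (simp only: eq bit_add_self)
  finally show ?thesis by simp
qed

section \<open>Duality between faces and edges\<close>

text \<open>
  Shifting every coordinate by one half, up (\<open>dual\<close>) or down (\<open>codual\<close>), maps the lattice to its dual
  lattice; the indexing by lower ends breaks the symmetry between the two directions.
\<close>

fun coord_dual :: "coord \<Rightarrow> coord" where
  "coord_dual (Pt n) = Iv n"
| "coord_dual (Iv n) = Pt (n + 1)"

fun coord_codual :: "coord \<Rightarrow> coord" where
  "coord_codual (Pt n) = Iv (n - 1)"
| "coord_codual (Iv n) = Pt n"

fun cell_dual :: "cell \<Rightarrow> cell" where
  "cell_dual (a, b, c) = (coord_dual a, coord_dual b, coord_dual c)"

fun cell_codual :: "cell \<Rightarrow> cell" where
  "cell_codual (a, b, c) = (coord_codual a, coord_codual b, coord_codual c)"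

lemma coord_dual_ends: "coord_dual a \<in> coord_ends b \<longleftrightarrow> coord_codual b \<in> coord_ends a"
  by (cases a; cases b) auto

text \<open>
  Passing to the dual lattice reverses incidence. This is the reason for the symmetry between the
  dressings of the two species.
\<close>

lemma cell_dual_boundary:
  "cell_dual c \<in> cell_boundary c' \<longleftrightarrow> cell_codual c' \<in> cell_boundary c"
proof -
  obtain x y z where c: "c = (x, y, z)" by (cases c)
  obtain x' y' z' where c': "c' = (x', y', z')" by (cases c')
  have eq: "coord_dual a = b \<longleftrightarrow> coord_codual b = a" for a b
    by (cases a; cases b) auto
  have mem: "(a, b, d) \<in> cell_boundary (a', b', d') \<longleftrightarrow>
      a \<in> coord_ends a' \<and> b = b' \<and> d = d' \<or> a = a' \<and> b \<in> coord_ends b' \<and> d = d'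
      \<or> a = a' \<and> b = b' \<and> d \<in> coord_ends d'" for a b d a' b' d'
    by auto
  show ?thesis
    unfolding c c' cell_dual.simps cell_codual.simps mem coord_dual_ends eq by blast
qed

lemma cell_dim_dual:
  "cell_dim (cell_dual c) = 3 - cell_dim c" "cell_dim (cell_codual c) = 3 - cell_dim c"
proof -
  have *: "coord_dim (coord_dual a) = 1 - coord_dim a"
    "coord_dim (coord_codual a) = 1 - coord_dim a" "coord_dim a \<le> 1" for a
    by (cases a; simp)+
  obtain x y z where c: "c = (x, y, z)" by (cases c)
  show "cell_dim (cell_dual c) = 3 - cell_dim c" "cell_dim (cell_codual c) = 3 - cell_dim c"
    using *(3)[of x] *(3)[of y] *(3)[of z] by (auto simp: c *)
qed

lemma cell_near_dual: "cell_near 1 c (cell_dual c)" "cell_near 1 c (cell_codual c)"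
proof -
  have "coord_near 1 a (coord_dual a)" "coord_near 1 a (coord_codual a)" for a
    by (cases a; simp)+
  then show "cell_near 1 c (cell_dual c)" "cell_near 1 c (cell_codual c)"
    by (cases c; simp del: coord_near.simps One_nat_def)+
qed

definition face_dual :: "face \<Rightarrow> edge" where
  "face_dual f = Edge (cell_dual (face_cell f))"

definition face_codual :: "face \<Rightarrow> edge" where
  "face_codual f = Edge (cell_codual (face_cell f))"

lemma edge_cell_face_dual:
  "edge_cell (face_dual f) = cell_dual (face_cell f)"
  "edge_cell (face_codual f) = cell_codual (face_cell f)"
  using face_cell[of f] by (simp_all add: face_dual_def face_codual_def Edge_inverse cell_dim_dual)

lemma face_cases:
  obtains (x) i j k where "face_cell f = (Pt i, Iv j, Iv k)"
    | (y) i j k where "face_cell f = (Iv i, Pt j, Iv k)"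
    | (z) i j k where "face_cell f = (Iv i, Iv j, Pt k)"
proof -
  obtain a b c where f: "face_cell f = (a, b, c)" by (cases "face_cell f")
  have "cell_dim (face_cell f) = 2" using face_cell[of f] by simp
  then show ?thesis using that by (cases a; cases b; cases c) (auto simp: f)
qed

lemma cup21_integral:
  "cube_integral (cup21 (face_cochain f) (edge_cochain e)) = of_bool (e = face_dual f)"
proof -
  have e: "e = face_dual f \<longleftrightarrow> edge_cell e = cell_dual (face_cell f)"
    by (simp flip: edge_cell_inject edge_cell_face_dual)
  have "\<exists>v0. cup21 (face_cochain f) (edge_cochain e) = (\<lambda>v. of_bool (v = v0 \<and> e = face_dual f))"
  proof (cases rule: face_cases[of f])
    case (x i j k)
    show ?thesis unfolding e
      by (rule exI[of _ "(i, j, k)"]) (auto simp: fun_eq_iff cup21_def indicator_cochain_def x)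
  next
    case (y i j k)
    show ?thesis unfolding e
      by (rule exI[of _ "(i, j, k)"]) (auto simp: fun_eq_iff cup21_def indicator_cochain_def y)
  next
    case (z i j k)
    show ?thesis unfolding e
      by (rule exI[of _ "(i, j, k)"]) (auto simp: fun_eq_iff cup21_def indicator_cochain_def z)
  qed
  then show ?thesis by (metis cube_integral_def Sum_any_of_bool_eq)
qed

text \<open>
  Here the face is an upper face of the cube on which the product is nonzero, which accounts for the
  cubes chosen in the proof.
\<close>

lemma cup12_integral:
  "cube_integral (cup12 (edge_cochain e) (face_cochain f)) = of_bool (e = face_codual f)"
proof -
  have e: "e = face_codual f \<longleftrightarrow> edge_cell e = cell_codual (face_cell f)"
    by (simp flip: edge_cell_inject edge_cell_face_dual)
  have "\<exists>v0. cup12 (edge_cochain e) (face_cochain f) = (\<lambda>v. of_bool (v = v0 \<and> e = face_codual f))"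
  proof (cases rule: face_cases[of f])
    case (x i j k)
    show ?thesis unfolding e
      by (rule exI[of _ "(i - 1, j, k)"]) (auto simp: fun_eq_iff cup12_def indicator_cochain_def x)
  next
    case (y i j k)
    show ?thesis unfolding e
      by (rule exI[of _ "(i, j - 1, k)"]) (auto simp: fun_eq_iff cup12_def indicator_cochain_def y)
  next
    case (z i j k)
    show ?thesis unfolding e
      by (rule exI[of _ "(i, j, k - 1)"]) (auto simp: fun_eq_iff cup12_def indicator_cochain_def z)
  qed
  then show ?thesis by (metis cube_integral_def Sum_any_of_bool_eq)
qed

section \<open>Pauli operators\<close>

text \<open>
  By default sums and products of bits are rewritten to bit operations and then to truth values;
  bilinear computations need the ring operations.
\<close>

declare add_bit_eq_xor [simp del] mult_bit_eq_and [simp del]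
declare bit_add_self [simp]

lemma pauli_add_self: "(P::pauli) + P = 0"
  by (rule poly_mapping_eqI) (simp add: lookup_add zero_prod_def plus_prod_def prod_eq_iff)

lemma pauli_add_cancel: "(P::pauli) + (P + Q) = Q"
  by (simp add: pauli_add_self flip: add.assoc)

lemma pauli_pow_0 [simp]: "pauli_pow P 0 = 0" and pauli_pow_1 [simp]: "pauli_pow P 1 = P"
  and pauli_pow_zero [simp]: "pauli_pow 0 b = 0"
  by (simp_all add: pauli_pow_def)

lemma pauli_pow_bit_add: "pauli_pow P (a + b) = pauli_pow P a + pauli_pow P b"
  by (cases a; cases b) (simp_all add: pauli_pow_def pauli_add_self)

lemma pauli_pow_add: "pauli_pow (P + Q) a = pauli_pow P a + pauli_pow Q a"
  by (simp add: pauli_pow_def)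

lemma pauli_pow_bit_sum: "finite I \<Longrightarrow> pauli_pow P (\<Sum>i\<in>I. a i) = (\<Sum>i\<in>I. pauli_pow P (a i))"
  by (induction I rule: finite_induct) (simp_all only: sum.empty sum.insert pauli_pow_bit_add pauli_pow_0 simp_thms if_False)

lemma pauli_pow_of_bool: "pauli_pow P (of_bool b) = (if b then P else 0)"
  by (simp add: pauli_pow_def)

lemma finite_pauli_pow: "finite {i. a i \<noteq> 0} \<Longrightarrow> finite {i. pauli_pow (P i) (a i) \<noteq> 0}"
  by (erule rev_finite_subset) (auto simp: pauli_pow_def)

lemma commutator_exponent_sum:
  assumes "finite A" "Poly_Mapping.keys P \<subseteq> A"
  shows "commutator_exponent P Q = (\<Sum>q\<in>A.
    fst (Poly_Mapping.lookup P q) * snd (Poly_Mapping.lookup Q q) +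
    snd (Poly_Mapping.lookup P q) * fst (Poly_Mapping.lookup Q q))"
  unfolding commutator_exponent_def
proof (rule Sum_any_eq_sum[OF assms(1)])
  fix q assume "q \<notin> A"
  with assms(2) have "Poly_Mapping.lookup P q = 0" by (auto simp: in_keys_iff)
  then show "fst (Poly_Mapping.lookup P q) * snd (Poly_Mapping.lookup Q q) +
      snd (Poly_Mapping.lookup P q) * fst (Poly_Mapping.lookup Q q) = 0" by simp
qed

lemma commutator_exponent_commute: "commutator_exponent P Q = commutator_exponent Q P"
  unfolding commutator_exponent_def by (simp only: ac_simps)

lemma additive_commutator_exponent: "additive (\<lambda>P. commutator_exponent P Q)"
proof
  fix P P' :: pauli
  let ?A = "Poly_Mapping.keys P \<union> Poly_Mapping.keys P'"
  have "Poly_Mapping.keys (P + P') \<subseteq> ?A" by (rule Poly_Mapping.keys_add)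
  then show "commutator_exponent (P + P') Q = commutator_exponent P Q + commutator_exponent P' Q"
    by (simp add: commutator_exponent_sum[of ?A] lookup_add distrib_right distrib_left sum.distrib ac_simps)
qed

lemma additive_commutator_exponent': "additive (commutator_exponent P)"
  using additive_commutator_exponent[of P]
  by (subst commutator_exponent_commute[abs_def])

lemma commutator_exponent_pow: "commutator_exponent (pauli_pow P a) Q = a * commutator_exponent P Q"
  by (simp add: pauli_pow_def additive.zero[OF additive_commutator_exponent])

lemma commutator_exponent_pauliX: "commutator_exponent (pauliX s f) Q = snd (Poly_Mapping.lookup Q (s, f))"
  by (simp add: commutator_exponent_sum[of "{(s, f)}"] pauliX_def)

lemma commutator_exponent_pauliZ: "commutator_exponent (pauliZ s f) Q = fst (Poly_Mapping.lookup Q (s, f))"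
  by (simp add: commutator_exponent_sum[of "{(s, f)}"] pauliZ_def)

lemma commutator_exponent_nondegenerate:
  assumes "\<And>Q. commutator_exponent P Q = 0"
  shows "P = 0"
proof (rule poly_mapping_eqI)
  fix q :: qubit
  obtain s f where q: "q = (s, f)" by (cases q)
  show "Poly_Mapping.lookup P q = Poly_Mapping.lookup 0 q"
    using assms[of "pauliX s f"] assms[of "pauliZ s f"]
    by (simp add: commutator_exponent_commute[of P] commutator_exponent_pauliX
        commutator_exponent_pauliZ q zero_prod_def prod_eq_iff)
qed

lemma additive_determined_by_generators:
  fixes \<alpha> \<beta> :: "pauli \<Rightarrow> pauli"
  assumes "additive \<alpha>" "additive \<beta>"
    and X: "\<And>s f. \<alpha> (pauliX s f) = \<beta> (pauliX s f)" and Z: "\<And>s f. \<alpha> (pauliZ s f) = \<beta> (pauliZ s f)"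
  shows "\<alpha> = \<beta>"
proof
  interpret \<alpha>: additive \<alpha> by fact
  interpret \<beta>: additive \<beta> by fact
  fix P :: pauli
  have single: "\<alpha> (Poly_Mapping.single q p) = \<beta> (Poly_Mapping.single q p)" for q :: qubit and p
  proof -
    obtain s f where q: "q = (s, f)" by (cases q)
    have "Poly_Mapping.single q p = pauli_pow (pauliX s f) (fst p) + pauli_pow (pauliZ s f) (snd p)"
      by (cases p) (auto simp: pauli_pow_def pauliX_def pauliZ_def q simp flip: single_add zero_prod_def)
    then show ?thesis
      by (simp add: \<alpha>.add \<beta>.add pauli_pow_def X Z \<alpha>.zero \<beta>.zero)
  qed
  have "P = (\<Sum>q\<in>Poly_Mapping.keys P. Poly_Mapping.single q (Poly_Mapping.lookup P q))"
    by (rule poly_mapping_eqI) (auto simp: lookup_sum lookup_single when_def in_keys_iff)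
  then show "\<alpha> P = \<beta> P"
    by (metis (no_types, lifting) \<alpha>.sum \<beta>.sum single sum.cong)
qed

section \<open>Face operators factorizing the edge operators\<close>

text \<open>
  In contrast to \<open>opU\<close>, the face \<open>f\<close> is the first argument of the cup-1 product, as the coboundary is
  in \<open>opG\<close>. Therefore \<open>opG\<close> factorizes into these operators.
\<close>

definition opV :: "qubit \<Rightarrow> pauli" where
  "opV q = pauliX (fst q) (snd q) +
     Sum_any (\<lambda>f'. pauli_pow (pauliZ (fst q) f') (cup1_pairing (snd q) f'))"

lemma commutator_exponent_opV:
  "commutator_exponent (opV (s, f)) Q = snd (Poly_Mapping.lookup Q (s, f)) +
     Sum_any (\<lambda>f'. cup1_pairing f f' * fst (Poly_Mapping.lookup Q (s, f')))"
  unfolding opV_def fst_conv snd_conv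
  by (simp only: additive.add[OF additive_commutator_exponent]
      additive_Sum_any[OF additive_commutator_exponent finite_pauli_pow[OF finite_cup1_pairing]]
      commutator_exponent_pauliX commutator_exponent_pauliZ commutator_exponent_pow)

text \<open>
  This lemma and the next one say that commutation with \<open>opV\<close> reads off the exponents of the
  dressings in \<open>Xbar\<close> and \<open>Zbar\<close>.
\<close>

lemma commutator_exponent_pauliX_opV:
  "commutator_exponent (pauliX s' f') (opV (s, f)) = of_bool (s = s') * cup1_pairing f f'"
proof -
  have "snd (Poly_Mapping.lookup (pauliX s' f') q) = 0"
    "fst (Poly_Mapping.lookup (pauliX s' f') q) = of_bool (q = (s', f'))" for q
    by (auto simp: pauliX_def lookup_single when_def)
  then have "commutator_exponent (opV (s, f)) (pauliX s' f') =
      Sum_any (\<lambda>g. cup1_pairing f g * of_bool (s = s' \<and> g = f'))"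
    by (simp add: commutator_exponent_opV)
  also have "\<dots> = of_bool (s = s') * cup1_pairing f f'"
    by (subst Sum_any_eq_sum[of "{f'}"]) auto
  finally show ?thesis by (simp add: commutator_exponent_commute)
qed

lemma commutator_exponent_pauliZ_opV:
  "commutator_exponent (pauliZ s' f') (opV q) = of_bool (q = (s', f'))"
proof -
  have "fst (Poly_Mapping.lookup (pauliZ s' f') q) = 0"
    "snd (Poly_Mapping.lookup (pauliZ s' f') q) = of_bool (q = (s', f'))" for q
    by (auto simp: pauliZ_def lookup_single when_def)
  then have "commutator_exponent (opV q) (pauliZ s' f') = of_bool (q = (s', f'))"
    by (cases q) (simp add: commutator_exponent_opV)
  then show ?thesis by (simp add: commutator_exponent_commute)
qed

lemma commutator_exponent_opV_opV:
  "commutator_exponent (opV (s, f)) (opV (s', f')) =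
     of_bool (s = s') * (cup1_pairing f f' + cup1_pairing f' f)"
proof -
  have "commutator_exponent (opV (s, f)) (opV (s', f')) =
      commutator_exponent (pauliX s f) (opV (s', f')) +
      Sum_any (\<lambda>g. cup1_pairing f g * commutator_exponent (pauliZ s g) (opV (s', f')))"
    by (simp only: commutator_exponent_opV[of s f] commutator_exponent_pauliX commutator_exponent_pauliZ)
  also have "Sum_any (\<lambda>g. cup1_pairing f g * commutator_exponent (pauliZ s g) (opV (s', f'))) =
      of_bool (s = s') * cup1_pairing f f'"
    unfolding commutator_exponent_pauliZ_opV by (subst Sum_any_eq_sum[of "{f'}"]) auto
  finally show ?thesis
    by (auto simp: commutator_exponent_pauliX_opV ac_simps)
qed

lemma opG_eq: "opG s e = (\<Sum>f\<in>cofaces e. opV (s, f))"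
proof -
  have "Sum_any (\<lambda>f. pauli_pow (pauliX s f) (coboundary (edge_cochain e) (face_cell f))) =
      (\<Sum>f\<in>cofaces e. pauliX s f)"
    by (subst Sum_any_eq_sum[of "cofaces e"])
      (auto simp: coboundary_indicator pauli_pow_of_bool finite_cofaces, auto simp: cofaces_def)
  moreover have "Sum_any (\<lambda>f'. pauli_pow (pauliZ s f')
       (cube_integral (cup1 (coboundary (edge_cochain e)) (face_cochain f')))) =
      (\<Sum>f\<in>cofaces e. Sum_any (\<lambda>f'. pauli_pow (pauliZ s f') (cup1_pairing f f')))"
    unfolding cup1_integral_coboundary pauli_pow_bit_sum[OF finite_cofaces]
    by (intro Sum_any_sum finite_cofaces finite_pauli_pow finite_cup1_pairing)
  ultimately show ?thesis by (simp add: opG_def opV_def sum.distrib)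
qed

lemma opG_commute: "commutator_exponent (opG s e) (opG s' e') = 0"
proof -
  have "commutator_exponent (opG s e) (opG s' e') =
      (\<Sum>f\<in>cofaces e. \<Sum>f'\<in>cofaces e'. commutator_exponent (opV (s, f)) (opV (s', f')))"
    unfolding opG_eq additive.sum[OF additive_commutator_exponent]
    by (intro sum.cong refl additive.sum[OF additive_commutator_exponent'])
  also have "\<dots> = of_bool (s = s') *
      (\<Sum>f\<in>cofaces e. \<Sum>f'\<in>cofaces e'. cup1_pairing f f' + cup1_pairing f' f)"
    by (simp only: commutator_exponent_opV_opV sum_distrib_left)
  finally show ?thesis by (simp only: cofaces_pairing_alternating mult_zero_right)
qed

text \<open>The qubits whose operators \<open>opV\<close> make up the dressing of a given qubit; see \<open>dressing_eq_opV\<close>.\<close>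

fun linked :: "qubit \<Rightarrow> qubit \<Rightarrow> bool" where
  "linked (SpA, f) (SpB, f') \<longleftrightarrow> f' \<in> cofaces (face_dual f)"
| "linked (SpB, f) (SpA, f') \<longleftrightarrow> f' \<in> cofaces (face_codual f)"
| "linked _ _ \<longleftrightarrow> False"

abbreviation qubit_dressing :: "qubit \<Rightarrow> pauli" where
  "qubit_dressing q \<equiv> dressing (fst q) (snd q)"

lemma linked_commute: "linked q q' \<longleftrightarrow> linked q' q"
  by (cases "(q, q')" rule: linked.cases)
    (auto simp: cofaces_def edge_cell_face_dual cell_dual_boundary)

lemma dressing_eq_opG:
  "dressing SpA f = opG SpB (face_dual f)" "dressing SpB f = opG SpA (face_codual f)"
  unfolding dressing.simps cup21_integral cup12_integral pauli_pow_of_bool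
  by (subst Sum_any_eq_sum[of "{face_dual f}"]; simp) (subst Sum_any_eq_sum[of "{face_codual f}"]; simp)

lemma linked_set:
  "{q. linked (SpA, f) q} = Pair SpB ` cofaces (face_dual f)"
  "{q. linked (SpB, f) q} = Pair SpA ` cofaces (face_codual f)"
  by (auto elim: linked.elims)

lemma finite_linked: "finite {q'. linked q q'}"
proof (cases q)
  case (Pair s f)
  then show ?thesis by (cases s) (simp_all add: linked_set finite_cofaces)
qed

lemma dressing_eq_opV: "qubit_dressing q = (\<Sum>q'\<in>{q'. linked q q'}. opV q')"
proof (cases q)
  case (Pair s f)
  then show ?thesis
    by (cases s) (simp_all add: linked_set dressing_eq_opG opG_eq sum.reindex inj_on_def del: dressing.simps)
qed

lemma dressing_commute: "commutator_exponent (qubit_dressing q) (qubit_dressing q') = 0"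
  by (cases "fst q"; cases "fst q'") (simp_all only: dressing_eq_opG opG_commute)

section \<open>The automorphism\<close>

definition opV_support :: "pauli \<Rightarrow> qubit set" where
  "opV_support P = {q. commutator_exponent P (opV q) \<noteq> 0}"

abbreviation qubit_near :: "nat \<Rightarrow> qubit \<Rightarrow> qubit \<Rightarrow> bool" where
  "qubit_near r q q' \<equiv> cell_near r (face_cell (snd q)) (face_cell (snd q'))"

lemma opV_support_near:
  assumes "q \<in> opV_support P"
  shows "\<exists>q'\<in>Poly_Mapping.keys P. qubit_near 1 q q'"
proof (rule ccontr)
  assume far: "\<not> ?thesis"
  obtain s f where q: "q = (s, f)" by (cases q)
  have 0: "Poly_Mapping.lookup P q' = 0" if "qubit_near 1 q q'" for q'
    using far that by (auto simp: in_keys_iff)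
  have "cup1_pairing f f' * fst (Poly_Mapping.lookup P (s, f')) = 0" for f'
  proof (cases "cup1_pairing f f' = 0")
    case False
    then show ?thesis using 0[of "(s, f')"] cup1_pairing_near[of f f'] by (simp add: q)
  qed simp
  then have "Sum_any (\<lambda>f'. cup1_pairing f f' * fst (Poly_Mapping.lookup P (s, f'))) = 0"
    by (simp only: Sum_any.neutral)
  then have "commutator_exponent (opV q) P = 0"
    using 0[of q] by (simp add: commutator_exponent_opV q cell_near_refl)
  with assms show False by (simp add: opV_support_def commutator_exponent_commute)
qed

lemma finite_qubit_near: "finite {q'. qubit_near r q q'}"
proof (rule finite_subset)
  show "{q'. qubit_near r q q'} \<subseteq> {SpA, SpB} \<times> {f. cell_near r (face_cell (snd q)) (face_cell f)}"
  proof
    fix q' assume "q' \<in> {q'. qubit_near r q q'}"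
    then show "q' \<in> {SpA, SpB} \<times> {f. cell_near r (face_cell (snd q)) (face_cell f)}"
      by (cases q'; cases "fst q'") simp_all
  qed
qed (simp add: finite_face_near)

lemma finite_opV_support: "finite (opV_support P)"
proof (rule finite_subset)
  show "opV_support P \<subseteq> (\<Union>q'\<in>Poly_Mapping.keys P. {q. qubit_near 1 q' q})"
    using opV_support_near cell_near_sym by fast
qed (simp add: finite_qubit_near del: One_nat_def)

text \<open>
  The nilpotent part of the automorphism. As an operator of order 2 enters a product with
  exponent 0 or 1, the sum over the support is the sum of all dressings with exponents
  \<open>commutator_exponent P (opV q)\<close>; \<open>twist_eq\<close> states this form, which is linear in \<open>P\<close>.
\<close>

definition twist :: "pauli \<Rightarrow> pauli" where
  "twist P = (\<Sum>q\<in>opV_support P. qubit_dressing q)"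

lemma twist_eq:
  assumes "finite A" "opV_support P \<subseteq> A"
  shows "twist P = (\<Sum>q\<in>A. pauli_pow (qubit_dressing q) (commutator_exponent P (opV q)))"
  unfolding twist_def using assms
  by (intro sum.mono_neutral_cong_left) (auto simp: opV_support_def pauli_pow_def)

lemma additive_twist: "additive twist"
proof
  fix P P'
  let ?A = "opV_support P \<union> opV_support P'"
  have "finite ?A" by (simp add: finite_opV_support)
  moreover have "opV_support (P + P') \<subseteq> ?A"
    by (auto simp: opV_support_def additive.add[OF additive_commutator_exponent])
  ultimately show "twist (P + P') = twist P + twist P'"
    by (simp add: twist_eq[of ?A] additive.add[OF additive_commutator_exponent] pauli_pow_bit_add sum.distrib)
qed

lemma twist_pauliZ: "twist (pauliZ s f) = dressing s f"
  by (subst twist_eq[of "{(s, f)}"]) (auto simp: opV_support_def commutator_exponent_pauliZ_opV)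

lemma twist_pauliX:
  "twist (pauliX s f) = Sum_any (\<lambda>f'. pauli_pow (dressing s f') (cup1_pairing f' f))"
proof -
  let ?F = "{f'. cup1_pairing f' f \<noteq> 0}"
  have "twist (pauliX s f) = (\<Sum>q\<in>Pair s ` ?F. pauli_pow (qubit_dressing q) (commutator_exponent (pauliX s f) (opV q)))"
    by (rule twist_eq) (auto simp: opV_support_def commutator_exponent_pauliX_opV finite_cup1_pairing' simp del: bit_not_zero_iff)
  also have "\<dots> = (\<Sum>f'\<in>?F. pauli_pow (dressing s f') (cup1_pairing f' f))"
    by (subst sum.reindex) (auto simp: inj_on_def commutator_exponent_pauliX_opV)
  also have "\<dots> = Sum_any (\<lambda>f'. pauli_pow (dressing s f') (cup1_pairing f' f))"
    by (rule Sum_any_eq_sum[symmetric]) (auto simp: finite_cup1_pairing' simp del: bit_not_zero_iff)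
  finally show ?thesis .
qed

text \<open>Expanding the dressings turns the form into one that is symmetric because \<open>linked\<close> is.\<close>

lemma commutator_exponent_twist_sum:
  "commutator_exponent (twist P) Q =
     (\<Sum>q\<in>opV_support P. \<Sum>q'\<in>opV_support Q. of_bool (linked q q'))"
proof -
  have "commutator_exponent (qubit_dressing q) Q = (\<Sum>q'\<in>opV_support Q. of_bool (linked q q'))" for q
  proof -
    have "commutator_exponent (qubit_dressing q) Q = (\<Sum>q'\<in>{q'. linked q q'}. of_bool (q' \<in> opV_support Q))"
      unfolding dressing_eq_opV additive.sum[OF additive_commutator_exponent]
      by (intro sum.cong refl) (auto simp: opV_support_def commutator_exponent_commute)
    also have "\<dots> = (\<Sum>q'\<in>{q'. linked q q'} \<inter> opV_support Q. 1)"
      by (rule sum.mono_neutral_cong_right) (auto simp: finite_linked)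
    also have "\<dots> = (\<Sum>q'\<in>opV_support Q. of_bool (linked q q'))"
      by (rule sum.mono_neutral_cong_left) (auto simp: finite_opV_support)
    finally show ?thesis .
  qed
  then show ?thesis
    by (simp only: twist_def additive.sum[OF additive_commutator_exponent])
qed

lemma twist_self_adjoint: "commutator_exponent (twist P) Q = commutator_exponent P (twist Q)"
proof -
  have "commutator_exponent (twist P) Q = commutator_exponent (twist Q) P"
    unfolding commutator_exponent_twist_sum by (subst sum.swap) (simp only: linked_commute)
  then show ?thesis by (simp only: commutator_exponent_commute)
qed

text \<open>Both arguments are products of the mutually commuting operators \<open>opG\<close>.\<close>

lemma twist_isotropic: "commutator_exponent (twist P) (twist Q) = 0"
  unfolding twist_def additive.sum[OF additive_commutator_exponent]
    additive.sum[OF additive_commutator_exponent'] dressing_commute by simp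

lemma twist_twist: "twist (twist P) = 0"
  by (rule commutator_exponent_nondegenerate) (simp only: twist_self_adjoint[of "twist P"] twist_isotropic)

lemma opV_keys_near: "q' \<in> Poly_Mapping.keys (opV q) \<Longrightarrow> qubit_near 1 q q'"
proof -
  assume q': "q' \<in> Poly_Mapping.keys (opV q)"
  obtain s f where q: "q = (s, f)" by (cases q)
  obtain s' f' where q'_eq: "q' = (s', f')" by (cases q')
  have "fst (Poly_Mapping.lookup (opV q) q') \<noteq> 0 \<or> snd (Poly_Mapping.lookup (opV q) q') \<noteq> 0"
    using q' by (auto simp: in_keys_iff prod_eq_iff simp del: bit_not_zero_iff)
  then have "q = q' \<or> cup1_pairing f f' \<noteq> 0"
    by (auto simp: q q'_eq simp flip: commutator_exponent_pauliX commutator_exponent_pauliZ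
        simp: commutator_exponent_pauliX_opV commutator_exponent_pauliZ_opV split: if_splits)
  then show "qubit_near 1 q q'"
    using cup1_pairing_near[of f f'] by (auto simp: q q'_eq cell_near_refl simp del: One_nat_def)
qed

lemma linked_near: "linked q q' \<Longrightarrow> qubit_near 2 q q'"
proof -
  have *: "cell_near 2 (face_cell f) (face_cell f')"
    if "f' \<in> cofaces e" "e = face_dual f \<or> e = face_codual f" for f f' e
  proof -
    have "cell_near 1 (face_cell f) (edge_cell e)"
      using that(2) cell_near_dual[of "face_cell f"] by (auto simp only: edge_cell_face_dual)
    from cell_near_trans[OF this cofaces_near[OF that(1)]] show ?thesis by (simp only: one_add_one)
  qed
  assume "linked q q'"
  then show ?thesis by (cases "(q, q')" rule: linked.cases) (auto intro: *)
qed

text \<open>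
  The radius is composed of 1 from \<open>q\<close> to the index of a factor \<open>opV\<close>, 2 from there across the dual edge to the
  dressed qubit, and 1 to a qubit of \<open>P\<close>.
\<close>

lemma twist_keys_near:
  assumes "q \<in> Poly_Mapping.keys (twist P)"
  shows "\<exists>q'\<in>Poly_Mapping.keys P. qubit_near 4 q q'"
proof -
  obtain q1 where q1: "q1 \<in> opV_support P" "q \<in> Poly_Mapping.keys (qubit_dressing q1)"
    using assms keys_sum[of qubit_dressing "opV_support P"] unfolding twist_def by auto
  then obtain q2 where q2: "linked q1 q2" "q \<in> Poly_Mapping.keys (opV q2)"
    using keys_sum[of opV "{q'. linked q1 q'}"] unfolding dressing_eq_opV by auto
  obtain q3 where q3: "q3 \<in> Poly_Mapping.keys P" "qubit_near 1 q1 q3"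
    using opV_support_near q1(1) by blast
  have "qubit_near (1 + 2 + 1) q q3"
    using opV_keys_near[OF q2(2)] linked_near[OF q2(1)] q3(2)
    by (blast intro: cell_near_trans cell_near_sym)
  moreover have "1 + 2 + 1 = (4::nat)" by simp
  ultimately show ?thesis using q3(1) by metis
qed

definition three_fermion_QCA :: "pauli \<Rightarrow> pauli" where
  "three_fermion_QCA P = P + twist P"

text \<open>The \<open>Z\<close>-part of \<open>opU\<close> cancels the undressed part of the product of the \<open>Zbar\<close>.\<close>

lemma Xbar_eq:
  "Xbar s f = pauliX s f + Sum_any (\<lambda>f'. pauli_pow (dressing s f') (cup1_pairing f' f))"
proof -
  let ?Z = "Sum_any (\<lambda>f'. pauli_pow (pauliZ s f') (cup1_pairing f' f))"
  have "Xbar s f = pauliX s f + ?Z + (?Z + Sum_any (\<lambda>f'. pauli_pow (dressing s f') (cup1_pairing f' f)))"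
    unfolding Xbar_def opU_def Zbar_def pauli_pow_add cup1_pairing_def[symmetric]
    by (subst Sum_any.distrib) (simp_all only: finite_pauli_pow finite_cup1_pairing')
  then show ?thesis by (simp only: add.assoc pauli_add_cancel)
qed

lemma three_fermion_assignment_QCA: "three_fermion_assignment three_fermion_QCA"
  unfolding three_fermion_assignment_def three_fermion_QCA_def
  by (simp add: twist_pauliX twist_pauliZ Xbar_eq Zbar_def)

lemma additive_three_fermion_QCA: "additive three_fermion_QCA"
  by standard (simp add: three_fermion_QCA_def additive.add[OF additive_twist])

lemma three_fermion_QCA_involution: "three_fermion_QCA \<circ> three_fermion_QCA = id"
proof
  fix P
  have "(three_fermion_QCA \<circ> three_fermion_QCA) P = P + (twist P + twist P)"
    by (simp add: three_fermion_QCA_def additive.add[OF additive_twist] twist_twist add.assoc)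
  then show "(three_fermion_QCA \<circ> three_fermion_QCA) P = id P" by (simp add: pauli_add_self)
qed

lemma commutator_exponent_three_fermion_QCA:
  "commutator_exponent (three_fermion_QCA P) (three_fermion_QCA Q) = commutator_exponent P Q"
  unfolding three_fermion_QCA_def additive.add[OF additive_commutator_exponent]
    additive.add[OF additive_commutator_exponent'] twist_isotropic twist_self_adjoint[of P Q]
  by (simp add: twist_isotropic add.assoc)

lemma locality_preserving_three_fermion_QCA: "locality_preserving three_fermion_QCA"
  unfolding locality_preserving_def
proof (intro exI allI ballI)
  fix P q
  assume "q \<in> Poly_Mapping.keys (three_fermion_QCA P)"
  then have "q \<in> Poly_Mapping.keys P \<or> q \<in> Poly_Mapping.keys (twist P)"
    using Poly_Mapping.keys_add[of P "twist P"] by (auto simp: three_fermion_QCA_def)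
  then have "\<exists>q'\<in>Poly_Mapping.keys P. qubit_near 4 q q'"
    using twist_keys_near cell_near_refl by blast
  then show "\<exists>q'\<in>Poly_Mapping.keys P. dist (qubit_position q) (qubit_position q') \<le> 3 * real 4"
    unfolding qubit_position_def using dist_cell_near by blast
qed

theorem mainTheorem1:
  shows "(\<forall>s f. Xbar s f = pauliX s f +
             Sum_any (\<lambda>f'. pauli_pow (dressing s f')
               (cube_integral (cup1 (face_cochain f') (face_cochain f))))) \<and>
         (\<exists>\<alpha>. clifford_QCA \<alpha> \<and> three_fermion_assignment \<alpha> \<and>
              (\<forall>\<beta>. additive \<beta> \<and> three_fermion_assignment \<beta> \<longrightarrow> \<beta> = \<alpha>) \<and>
              \<alpha> \<circ> \<alpha> = id)"
proof (intro conjI exI[of _ three_fermion_QCA] allI impI)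
  show "Xbar s f = pauliX s f + Sum_any (\<lambda>f'. pauli_pow (dressing s f')
      (cube_integral (cup1 (face_cochain f') (face_cochain f))))" for s f
    unfolding Xbar_eq cup1_pairing_def ..
  show "clifford_QCA three_fermion_QCA"
    using o_bij[OF three_fermion_QCA_involution three_fermion_QCA_involution]
    by (simp add: clifford_QCA_def pauli_commute_def additive_three_fermion_QCA
        commutator_exponent_three_fermion_QCA locality_preserving_three_fermion_QCA)
  show "\<beta> = three_fermion_QCA" if "additive \<beta> \<and> three_fermion_assignment \<beta>" for \<beta>
    using that additive_three_fermion_QCA three_fermion_assignment_QCA
    by (intro additive_determined_by_generators) (auto simp: three_fermion_assignment_def)
qed (fact three_fermion_assignment_QCA three_fermion_QCA_involution)+

end
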